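(* For $N\ge 3$ let two walkers perform independent simple random walks on the torus $(\mathbb{Z}/N\mathbb{Z})^2$: at each step, each walker at $(x,y)$ independently stays at $(x,y)$ or moves to one of $(x+1,y)$, $(x-1,y)$, $(x,y+1)$, $(x,y-1)$, each of these five options having probability $\tfrac15$. Let the initial positions be independent and uniformly distributed on the torus, and let $\tau_N$ be the meeting time. Then $\mathbf{E}[\tau_N]=\Theta(N^2\log N)$ as $N\to\infty$; that is, there are constants $0<c\le C$ such that $cN^2\log N\le \mathbf{E}[\tau_N]\le CN^2\log N$ for all sufficiently large $N$.
   Context: Time is discrete and both walkers move simultaneously in each time slot. The meeting time is the first time $t\ge 0$ at which the two walkers are at the same vertex. *)

theory Defs
  imports "HOL-Probability.Probability"
begin

(* (Z/NZ)^2, each residue class being represented by its element of {0..<N}. *)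
definition torus :: "nat \<Rightarrow> (int \<times> int) set" where
  "torus N = {0..<int N} \<times> {0..<int N}"

definition torus_add :: "nat \<Rightarrow> int \<times> int \<Rightarrow> int \<times> int \<Rightarrow> int \<times> int" where
  "torus_add N v d = ((fst v + fst d) mod int N, (snd v + snd d) mod int N)"

definition torus_step :: "nat \<Rightarrow> int \<times> int \<Rightarrow> (int \<times> int) pmf" where
  "torus_step N v =
     map_pmf (torus_add N v) (pmf_of_set {(0, 0), (1, 0), (-1, 0), (0, 1), (0, -1)})"

(* The conditional probability in markov is given the whole past; it is
   required only for histories p that occur with positive probability. *)
locale torus_walk = prob_space M
  for N :: nat and M :: "'a measure" and X :: "nat \<Rightarrow> 'a \<Rightarrow> int \<times> int" +
  assumes random_position: "X t \<in> M \<rightarrow>\<^sub>M count_space (torus N)"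
    and uniform_start: "distr M (count_space (torus N)) (X 0) = uniform_count_measure (torus N)"
    and markov: "\<P>(\<omega> in M. \<forall>i\<le>t. X i \<omega> = p i) > 0 \<Longrightarrow>
      \<P>(\<omega> in M. X (Suc t) \<omega> = v \<bar> \<forall>i\<le>t. X i \<omega> = p i) = pmf (torus_step N (p t)) v"

(* Independence is that of the two trajectories as random elements of the path
   space, so it covers the initial positions together with all the moves. *)
locale independent_torus_walks =
  X: torus_walk N M X + Y: torus_walk N M Y
  for N :: nat and M :: "'a measure" and X Y :: "nat \<Rightarrow> 'a \<Rightarrow> int \<times> int" +
  assumes indep: "prob_space.indep_var M
      (\<Pi>\<^sub>M t\<in>UNIV. count_space (torus N)) (\<lambda>\<omega> t. X t \<omega>)
      (\<Pi>\<^sub>M t\<in>UNIV. count_space (torus N)) (\<lambda>\<omega> t. Y t \<omega>)"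

definition meeting_time ::
    "(nat \<Rightarrow> 'a \<Rightarrow> 'b) \<Rightarrow> (nat \<Rightarrow> 'a \<Rightarrow> 'b) \<Rightarrow> 'a \<Rightarrow> ennreal" where
  "meeting_time X Y \<omega> =
     (if \<exists>t. X t \<omega> = Y t \<omega> then of_nat (LEAST t. X t \<omega> = Y t \<omega>) else \<infinity>)"

end

theory Submission
  imports Defs
begin

text \<open>The difference of the two walkers is a random walk whose Fourier multipliers are the squares of
  the eigenvalues \<open>\<lambda>\<^sub>k\<close> of a single walker. Hence
  \<open>g x = (\<Sum>k\<noteq>0. (1 - cos (2\<pi> k\<cdot>x / N)) / (1 - \<lambda>\<^sub>k\<^sup>2))\<close> vanishes at 0, and one step of the difference
  walk decreases it by exactly 1 on average at every other point. So \<open>E[g(X\<^sub>t - Y\<^sub>t); \<tau> > t]\<close> decreases by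
  \<open>P(\<tau> > t)\<close> at step t, and it tends to 0 since g is bounded. Summing up, \<open>E[\<tau>]\<close> is the mean of g over
  the torus, which is \<open>\<Sum>k\<noteq>0. 1 / (1 - \<lambda>\<^sub>k\<^sup>2)\<close>. As \<open>1 - \<lambda>\<^sub>k\<^sup>2\<close> is of order \<open>|k|\<^sup>2 / N\<^sup>2\<close> with k
  measured from the nearest corner, this is of order \<open>N\<^sup>2\<close> times a harmonic sum.\<close>

section \<open>The Fourier series of the hitting time of the origin\<close>

definition phase :: "nat \<Rightarrow> int \<times> int \<Rightarrow> int \<times> int \<Rightarrow> real" where
  "phase N k x = 2 * pi * of_int (fst k * fst x + snd k * snd x) / real N"

definition eigval :: "nat \<Rightarrow> int \<times> int \<Rightarrow> real" where
  "eigval N k = (1 + 2 * cos (2 * pi * of_int (fst k) / real N)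
                   + 2 * cos (2 * pi * of_int (snd k) / real N)) / 5"

text \<open>At \<open>k = 0\<close> the eigenvalue is 1, so this mode must be left out.\<close>

definition potential :: "nat \<Rightarrow> int \<times> int \<Rightarrow> real" where
  "potential N x = (\<Sum>k\<in>torus N - {(0, 0)}. (1 - cos (phase N k x)) / (1 - (eigval N k)\<^sup>2))"

definition mean_hitting :: "nat \<Rightarrow> real" where
  "mean_hitting N = (\<Sum>k\<in>torus N - {(0, 0)}. 1 / (1 - (eigval N k)\<^sup>2))"

definition moves :: "(int \<times> int) set" where
  "moves = {(0, 0), (1, 0), (-1, 0), (0, 1), (0, -1)}"

lemma finite_torus [simp]: "finite (torus N)"
  by (simp add: torus_def)

lemma card_torus: "card (torus N) = N\<^sup>2"
  by (simp add: torus_def power2_eq_square)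

section \<open>Characters of the torus and their orthogonality\<close>

lemma phase_add: "phase N k (x + y) = phase N k x + phase N k y"
  and phase_diff: "phase N k (x - y) = phase N k x - phase N k y"
  by (simp_all add: phase_def algebra_simps add_divide_distrib diff_divide_distrib)

lemma phase_commute: "phase N k x = phase N x k"
  by (simp add: phase_def mult.commute)

text \<open>The terms are the powers of one \<open>N\<close>-th root of unity \<open>z\<close>, so
  the geometric sum vanishes unless \<open>z = 1\<close>.\<close>

lemma sum_cis_multiple:
  assumes "N > 0"
  shows "(\<Sum>j<N. cis (2 * pi * of_int (int j * n) / real N)) = (if int N dvd n then of_nat N else 0)"
proof -
  define z where "z = cis (2 * pi * of_int n / real N)"
  have zj: "cis (2 * pi * of_int (int j * n) / real N) = z ^ j" for j
  proof -
    have "2 * pi * of_int (int j * n) / real N = real j * (2 * pi * of_int n / real N)" by simp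
    then show ?thesis unfolding z_def Complex.DeMoivre by presburger
  qed
  have z1: "z = 1 \<longleftrightarrow> int N dvd n"
  proof -
    have "z = 1 \<longleftrightarrow> cos (2 * pi * of_int n / real N) = 1"
      unfolding z_def by (auto simp: complex_eq_iff cos_one_sin_zero)
    also have "\<dots> \<longleftrightarrow> (\<exists>m::int. 2 * pi * of_int n / real N = of_int m * (2 * pi))"
      unfolding cos_one_2pi_int by (simp only: mult.assoc)
    also have "\<dots> \<longleftrightarrow> (\<exists>m::int. real_of_int n = of_int (int N * m))"
      using assms by (simp add: field_simps)
    also have "\<dots> \<longleftrightarrow> int N dvd n"
      unfolding of_int_eq_iff by (auto simp: dvd_def)
    finally show ?thesis .
  qed
  have zN: "z ^ N = 1"
  proof -
    have "real N * (2 * pi * of_int n / real N) = 2 * pi * of_int n" using assms by simp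
    then show ?thesis by (simp only: z_def Complex.DeMoivre cis_multiple_2pi Ints_of_int)
  qed
  have "(\<Sum>j<N. z ^ j) = (if int N dvd n then of_nat N else 0)"
    using z1 zN by (simp add: sum_gp_strict)
  then show ?thesis by (simp only: zj)
qed

lemma sum_torus: "(\<Sum>k\<in>torus N. f k) = (\<Sum>a<N. \<Sum>b<N. f (int a, int b))"
proof -
  have "(\<Sum>k\<in>torus N. f k) = (\<Sum>(a, b)\<in>{..<N} \<times> {..<N}. f (int a, int b))"
    by (rule sum.reindex_bij_witness[of _ "\<lambda>(a, b). (int a, int b)" "\<lambda>(a, b). (nat a, nat b)"])
       (auto simp: torus_def)
  then show ?thesis by (simp add: sum.cartesian_product)
qed

lemma sum_cis_phase:
  assumes "N > 0"
  shows "(\<Sum>k\<in>torus N. cis (phase N k x)) =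
    (if int N dvd fst x \<and> int N dvd snd x then (of_nat N)\<^sup>2 else 0)"
proof -
  have "(\<Sum>k\<in>torus N. cis (phase N k x)) =
      (\<Sum>a<N. \<Sum>b<N. cis (2 * pi * of_int (int a * fst x) / real N)
                    * cis (2 * pi * of_int (int b * snd x) / real N))"
    unfolding sum_torus phase_def
    by (intro sum.cong refl) (simp add: cis_mult algebra_simps add_divide_distrib)
  also have "\<dots> = (\<Sum>a<N. cis (2 * pi * of_int (int a * fst x) / real N)) *
                  (\<Sum>b<N. cis (2 * pi * of_int (int b * snd x) / real N))"
    by (simp add: sum_product)
  finally show ?thesis
    unfolding sum_cis_multiple[OF assms] by (simp add: power2_eq_square)
qed

lemma sum_cos_phase:
  assumes "N > 0"
  shows "(\<Sum>k\<in>torus N. cos (phase N k x)) =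
    (if int N dvd fst x \<and> int N dvd snd x then (real N)\<^sup>2 else 0)"
proof -
  have "(\<Sum>k\<in>torus N. cos (phase N k x)) = Re (\<Sum>k\<in>torus N. cis (phase N k x))"
    by simp
  also have "\<dots> = (if int N dvd fst x \<and> int N dvd snd x then (real N)\<^sup>2 else 0)"
    unfolding sum_cis_phase[OF assms] by (simp add: Re_power2)
  finally show ?thesis .
qed

section \<open>Bounds on the eigenvalues and on the denominators of the Fourier series\<close>

lemma one_minus_eigval:
  "1 - eigval N k =
    4 / 5 * ((sin (pi * of_int (fst k) / real N))\<^sup>2 + (sin (pi * of_int (snd k) / real N))\<^sup>2)"
proof -
  \<comment> \<open>Half-angle form: squared sines are nonnegative and can be compared with squares
    of the frequencies.\<close>
  have cos_eq: "cos (2 * pi * r / real N) = 1 - 2 * (sin (pi * r / real N))\<^sup>2" for r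
    using cos_double_sin[of "pi * r / real N"] by (simp add: mult.assoc)
  show ?thesis
    unfolding eigval_def cos_eq by (simp add: field_simps)
qed

text \<open>Staying put has probability 1/5, which keeps the eigenvalues away from -1.\<close>

lemma eigval_bounds: "- 3 / 5 \<le> eigval N k" "eigval N k \<le> 1"
proof -
  have "- 3 \<le> 1 + 2 * cos x + 2 * cos y" "1 + 2 * cos x + 2 * cos y \<le> 5" for x y :: real
    using cos_ge_minus_one[of x] cos_le_one[of x] cos_ge_minus_one[of y] cos_le_one[of y] by linarith+
  then show "- 3 / 5 \<le> eigval N k" "eigval N k \<le> 1"
    unfolding eigval_def by simp_all
qed

text \<open>The factor \<open>1 + eigval N k\<close> lies between 2/5 and 2, so passing from one
  walker to the difference of two changes the spectral gap only by a bounded factor.\<close>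

lemma one_minus_eigval_square_bounds:
  "2 / 5 * (1 - eigval N k) \<le> 1 - (eigval N k)\<^sup>2"
  "1 - (eigval N k)\<^sup>2 \<le> 2 * (1 - eigval N k)"
proof -
  have eq: "1 - (eigval N k)\<^sup>2 = (1 + eigval N k) * (1 - eigval N k)"
    by (simp add: power2_eq_square algebra_simps)
  show "2 / 5 * (1 - eigval N k) \<le> 1 - (eigval N k)\<^sup>2"
    "1 - (eigval N k)\<^sup>2 \<le> 2 * (1 - eigval N k)"
    unfolding eq using eigval_bounds[of N k] by (intro mult_right_mono; simp)+
qed

text \<open>A coordinate strictly between 0 and \<open>N\<close> has a positive sine. This makes
  every denominator in \<open>potential\<close> and \<open>mean_hitting\<close> positive.\<close>

lemma eigval_less_one:
  assumes "k \<in> torus N - {(0, 0)}"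
  shows "eigval N k < 1" "0 < 1 - (eigval N k)\<^sup>2"
proof -
  have pos: "sin (pi * of_int a / real N) > 0" if "0 < a" "a < int N" for a
  proof (rule sin_gt_zero)
    show "0 < pi * of_int a / real N" using that by simp
    have "of_int a < real N" using that by linarith
    then show "pi * of_int a / real N < pi" using that by (simp add: field_simps)
  qed
  obtain a b where k: "k = (a, b)" by fastforce
  have "sin (pi * of_int a / real N) > 0 \<or> sin (pi * of_int b / real N) > 0"
    using assms pos[of a] pos[of b] unfolding k torus_def by auto
  then have "0 < (sin (pi * of_int a / real N))\<^sup>2 + (sin (pi * of_int b / real N))\<^sup>2"
    by (auto simp: add_pos_nonneg add_nonneg_pos)
  then show *: "eigval N k < 1"
    using one_minus_eigval[of N k] by (simp add: k)
  show "0 < 1 - (eigval N k)\<^sup>2"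
    using one_minus_eigval_square_bounds(1)[of N k] * by (simp add: field_simps)
qed

section \<open>The potential: bounds, periodicity, one-step decrease and mean\<close>

lemma potential_nonneg: "0 \<le> potential N x"
  unfolding potential_def
  using eigval_less_one by (intro sum_nonneg divide_nonneg_pos) auto

lemma potential_le: "potential N x \<le> 2 * mean_hitting N"
  unfolding potential_def mean_hitting_def sum_distrib_left
proof (rule sum_mono)
  fix k assume k: "k \<in> torus N - {(0, 0)}"
  have "1 - cos (phase N k x) \<le> 2"
    using cos_ge_minus_one[of "phase N k x"] by linarith
  then show "(1 - cos (phase N k x)) / (1 - (eigval N k)\<^sup>2) \<le> 2 * (1 / (1 - (eigval N k)\<^sup>2))"
    using eigval_less_one(2)[OF k] by (simp add: divide_right_mono)
qed

lemma potential_zero: "potential N 0 = 0"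
  by (simp add: potential_def phase_def)

lemma cos_add_2pi_int: "cos (x + 2 * pi * of_int n) = cos x"
  by (simp add: cos_add cos_int_2pin sin_int_2pin)

text \<open>All phases change by multiples of \<open>2 * pi\<close>. Differences of positions can
  therefore be taken in the integers, without reduction mod \<open>N\<close>.\<close>

lemma potential_cong:
  assumes "N > 0" "int N dvd fst x - fst y" "int N dvd snd x - snd y"
  shows "potential N x = potential N y"
proof -
  obtain a b where ab: "fst x = fst y + int N * a" "snd x = snd y + int N * b"
    using assms(2,3) by (metis add.commute diff_add_cancel dvd_def)
  have "phase N k x = phase N k y + 2 * pi * of_int (fst k * a + snd k * b)" for k
    unfolding phase_def ab using assms(1) by (simp add: field_simps)
  then have "cos (phase N k x) = cos (phase N k y)" for k
    by (simp only: cos_add_2pi_int)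
  then show ?thesis by (simp add: potential_def)
qed

text \<open>The set of moves is symmetric, so the sine parts cancel and each cosine mode is an
  eigenfunction of the step; 5 is the number of moves.\<close>

lemma sum_moves_cos_phase: "(\<Sum>d\<in>moves. cos (\<theta> + phase N k d)) = 5 * eigval N k * cos \<theta>"
  by (simp add: moves_def phase_def eigval_def cos_add cos_diff algebra_simps)

lemma sum_moves_moves_cos_phase:
  "(\<Sum>d\<in>moves. \<Sum>e\<in>moves. cos (phase N k (x + d - e))) = 25 * (eigval N k)\<^sup>2 * cos (phase N k x)"
proof -
  have neg: "(\<Sum>e\<in>moves. cos (\<theta> - phase N k e)) = 5 * eigval N k * cos \<theta>" for \<theta>
    by (simp add: moves_def phase_def eigval_def cos_add cos_diff algebra_simps)
  have "(\<Sum>d\<in>moves. \<Sum>e\<in>moves. cos (phase N k (x + d - e)))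
      = (\<Sum>d\<in>moves. 5 * eigval N k * cos (phase N k x + phase N k d))"
    by (simp add: phase_add phase_diff neg)
  also have "\<dots> = 5 * eigval N k * (5 * eigval N k * cos (phase N k x))"
    by (simp only: sum_distrib_left[symmetric] sum_moves_cos_phase)
  finally show ?thesis by (simp add: power2_eq_square)
qed

text \<open>With \<open>c\<close> the cosine and \<open>l\<close> the eigenvalue of a mode,
  \<open>(1 - l^2 c) / (1 - l^2) = (1 - c) / (1 - l^2) + c\<close>. The change under one step is
  thus the sum of the bare cosines, in which the denominators have disappeared.\<close>

lemma potential_step:
  assumes "N > 0" and "\<not> (int N dvd fst x \<and> int N dvd snd x)"
  shows "(\<Sum>d\<in>moves. \<Sum>e\<in>moves. potential N (x + d - e)) = 25 * (potential N x - 1)"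
proof -
  let ?K = "torus N - {(0, 0)}"
  have card_moves: "card moves = 5" by (simp add: moves_def)
  have zero: "(0, 0) \<in> torus N" using assms(1) by (simp add: torus_def)
  have "(\<Sum>d\<in>moves. \<Sum>e\<in>moves. potential N (x + d - e))
      = (\<Sum>k\<in>?K. \<Sum>d\<in>moves. \<Sum>e\<in>moves. (1 - cos (phase N k (x + d - e))) / (1 - (eigval N k)\<^sup>2))"
    unfolding potential_def by (subst (2) sum.swap, subst sum.swap) simp
  also have "\<dots> = (\<Sum>k\<in>?K. 25 * ((1 - cos (phase N k x)) / (1 - (eigval N k)\<^sup>2) + cos (phase N k x)))"
  proof (rule sum.cong[OF refl])
    fix k assume k: "k \<in> ?K"
    have "(\<Sum>d\<in>moves. \<Sum>e\<in>moves. (1 - cos (phase N k (x + d - e))) / (1 - (eigval N k)\<^sup>2))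
      = (25 - 25 * (eigval N k)\<^sup>2 * cos (phase N k x)) / (1 - (eigval N k)\<^sup>2)"
      by (simp add: sum_divide_distrib[symmetric] sum_subtractf sum_moves_moves_cos_phase card_moves)
    also have "\<dots> = 25 * ((1 - cos (phase N k x)) / (1 - (eigval N k)\<^sup>2) + cos (phase N k x))"
      using eigval_less_one(2)[OF k] by (simp add: field_simps)
    finally show "(\<Sum>d\<in>moves. \<Sum>e\<in>moves. (1 - cos (phase N k (x + d - e))) / (1 - (eigval N k)\<^sup>2))
      = 25 * ((1 - cos (phase N k x)) / (1 - (eigval N k)\<^sup>2) + cos (phase N k x))" .
  qed
  also have "\<dots> = 25 * (potential N x + (\<Sum>k\<in>?K. cos (phase N k x)))"
    by (simp only: sum_distrib_left[symmetric] sum.distrib potential_def)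
  \<comment> \<open>Over all modes the cosines sum to 0, since \<open>x\<close> is not 0 mod
    \<open>N\<close>; the omitted zero mode accounts for 1.\<close>
  also have "(\<Sum>k\<in>?K. cos (phase N k x)) = -1"
    using sum_cos_phase[OF assms(1), of x] assms(2) zero
    by (simp add: sum_diff1 phase_def)
  finally show ?thesis by simp
qed

text \<open>Summing over \<open>x\<close> removes the cosine of every nonzero mode. The shift by
  \<open>y\<close> only multiplies the character sum by a number of modulus 1.\<close>

lemma sum_potential:
  assumes "N > 0"
  shows "(\<Sum>x\<in>torus N. potential N (x - y)) = (real N)\<^sup>2 * mean_hitting N"
proof -
  have "(\<Sum>x\<in>torus N. potential N (x - y)) =
     (\<Sum>k\<in>torus N - {(0, 0)}. \<Sum>x\<in>torus N. (1 - cos (phase N k (x - y))) / (1 - (eigval N k)\<^sup>2))"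
    unfolding potential_def by (rule sum.swap)
  also have "\<dots> = (\<Sum>k\<in>torus N - {(0, 0)}. (real N)\<^sup>2 * (1 / (1 - (eigval N k)\<^sup>2)))"
  proof (rule sum.cong[OF refl])
    fix k assume k: "k \<in> torus N - {(0, 0)}"
    have ndvd: "\<not> (int N dvd fst k \<and> int N dvd snd k)"
      using k by (auto simp: torus_def dest: zdvd_not_zless)
         (metis le_less zdvd_not_zless)+
    have "(\<Sum>x\<in>torus N. cos (phase N k (x - y))) = Re (cis (- phase N k y) * (\<Sum>x\<in>torus N. cis (phase N k x)))"
      by (simp add: sum_distrib_left cis_mult phase_diff)
    \<comment> \<open>Orthogonality with point and frequency exchanged, as \<open>phase\<close> is
      symmetric in them.\<close>
    also have "(\<Sum>x\<in>torus N. cis (phase N k x)) = 0"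
      using ndvd sum_cis_phase[OF assms, of k] by (simp only: phase_commute[of N k] if_False)
    finally have "(\<Sum>x\<in>torus N. cos (phase N k (x - y))) = 0" by simp
    then show "(\<Sum>x\<in>torus N. (1 - cos (phase N k (x - y))) / (1 - (eigval N k)\<^sup>2)) =
       (real N)\<^sup>2 * (1 / (1 - (eigval N k)\<^sup>2))"
      by (simp add: sum_divide_distrib[symmetric] sum_subtractf card_torus)
  qed
  finally show ?thesis by (simp add: mean_hitting_def sum_distrib_left)
qed

section \<open>Logarithmic growth of the lattice sum\<close>

text \<open>Jordan's inequality: on \<open>[0, pi / 2]\<close> the concave sine lies above its
  chord, and \<open>2 / pi * x\<close> is the weight of the right endpoint.\<close>

lemma sin_ge_linear:
  fixes x :: real
  assumes "0 \<le> x" "x \<le> pi / 2"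
  shows "2 / pi * x \<le> sin x"
proof -
  have "concave_on {0..pi / 2} (sin :: real \<Rightarrow> real)"
  proof (rule f''_le0_imp_concave)
    fix x :: real assume "x \<in> {0..pi / 2}"
    then show "- sin x \<le> 0" by (simp add: sin_ge_zero)
  qed (auto intro!: derivative_eq_intros)
  from concave_onD[OF this, of "2 / pi * x" 0 "pi / 2"] assms show ?thesis
    by (simp add: field_simps)
qed

text \<open>Enlarging the square adds two sides and a corner. Both lattice sum bounds below are
  inductions over these shells.\<close>

lemma sum_Suc_square:
  fixes f :: "nat \<Rightarrow> nat \<Rightarrow> real"
  assumes "m \<le> Suc n"
  shows "(\<Sum>a=m..Suc n. \<Sum>b=m..Suc n. f a b) =
    (\<Sum>a=m..n. \<Sum>b=m..n. f a b) + ((\<Sum>a=m..n. f a (Suc n)) + (\<Sum>b=m..n. f (Suc n) b) + f (Suc n) (Suc n))"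
  using assms by (simp add: sum.distrib)

text \<open>The shell at distance \<open>Suc n\<close> has \<open>2 * Suc n + 1\<close> points, each
  contributing at most \<open>1 / (Suc n)^2\<close>, hence at most \<open>3 / Suc n\<close> in
  total. The term at the origin is \<open>1 / 0 = 0\<close>.\<close>

lemma sum_inverse_squares_le:
  "(\<Sum>a=0..n. \<Sum>b=0..n. 1 / ((real a)\<^sup>2 + (real b)\<^sup>2)) \<le> 3 * harm n"
proof (induction n)
  case (Suc n)
  define r where "r = 1 / (real (Suc n))\<^sup>2"
  have *: "1 / ((real a)\<^sup>2 + (real (Suc n))\<^sup>2) \<le> r" for a
    unfolding r_def by (intro divide_left_mono) (auto simp: add_nonneg_pos)
  define B where "B = real (Suc n) * r"
  have "(\<Sum>a=0..n. 1 / ((real a)\<^sup>2 + (real (Suc n))\<^sup>2)) \<le> B"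
    unfolding B_def
    using sum_bounded_above[of "{0..n}" "\<lambda>a. 1 / ((real a)\<^sup>2 + (real (Suc n))\<^sup>2)" r] * by simp
  moreover have "(\<Sum>b=0..n. 1 / ((real (Suc n))\<^sup>2 + (real b)\<^sup>2)) = (\<Sum>a=0..n. 1 / ((real a)\<^sup>2 + (real (Suc n))\<^sup>2))"
    by (simp add: add.commute)
  moreover have "B + B + r \<le> 3 * inverse (real (Suc n))"
    unfolding B_def r_def by (simp add: divide_simps power2_eq_square)
  ultimately show ?case
    using Suc *[of "Suc n"] unfolding sum_Suc_square[OF le0] harm_Suc distrib_left by linarith
qed (simp add: harm_def)

text \<open>One side of the shell with its corner suffices: \<open>Suc n\<close> points, each
  contributing at least \<open>1 / (2 * (Suc n)^2)\<close>.\<close>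

lemma sum_inverse_squares_ge:
  "harm n / 2 \<le> (\<Sum>a=1..n. \<Sum>b=1..n. 1 / ((real a)\<^sup>2 + (real b)\<^sup>2))"
proof (induction n)
  case (Suc n)
  let ?r = "1 / (2 * (real (Suc n))\<^sup>2)"
  have *: "?r \<le> 1 / ((real a)\<^sup>2 + (real (Suc n))\<^sup>2)" if "1 \<le> a" "a \<le> Suc n" for a
  proof (intro divide_left_mono)
    show "(real a)\<^sup>2 + (real (Suc n))\<^sup>2 \<le> 2 * (real (Suc n))\<^sup>2"
      using that power_mono[of "real a" "real (Suc n)" 2] by simp
  qed (auto simp: add_nonneg_pos intro!: mult_pos_pos)
  have "real n * ?r \<le> (\<Sum>a=1..n. 1 / ((real a)\<^sup>2 + (real (Suc n))\<^sup>2))"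
    using sum_bounded_below[of "{1..n}" ?r "\<lambda>a. 1 / ((real a)\<^sup>2 + (real (Suc n))\<^sup>2)"] * by simp
  moreover have "0 \<le> (\<Sum>b=1..n. 1 / ((real (Suc n))\<^sup>2 + (real b)\<^sup>2))"
    by (intro sum_nonneg) simp
  moreover have one: "1 \<le> Suc n" by simp
  moreover have "inverse (real (Suc n)) / 2 = real n * ?r + ?r"
    by (simp add: divide_simps power2_eq_square) (simp add: algebra_simps)
  ultimately show ?case
    using Suc *[of "Suc n"] unfolding sum_Suc_square[OF one] harm_Suc add_divide_distrib
    by linarith
qed (simp add: harm_def)

text \<open>From \<open>|sin x| <= |x|\<close>, the denominator is at most
  \<open>8 / 5 * pi^2 * (a^2 + b^2) / N^2\<close>. Modes with a zero coordinate are dropped, and the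
  factor 1/2 of \<open>sum_inverse_squares_ge\<close> turns \<open>5 / (8 * pi^2)\<close> into the
  stated constant.\<close>

lemma mean_hitting_ge:
  assumes "N \<ge> 3"
  shows "5 / (16 * pi\<^sup>2) * (real N)\<^sup>2 * ln (real N) \<le> mean_hitting N"
proof -
  let ?c = "5 / (8 * pi\<^sup>2) * (real N)\<^sup>2"
  let ?h = "\<lambda>k. 1 / (1 - (eigval N k)\<^sup>2)"
  let ?e = "\<lambda>(a, b). (int a, int b)"
  have "ln (real N) \<le> harm (N - 1)"
    using ln_le_harm[of "N - 1"] assms by (simp add: of_nat_diff)
  then have "?c * (ln (real N) / 2) \<le> ?c * (\<Sum>a=1..N-1. \<Sum>b=1..N-1. 1 / ((real a)\<^sup>2 + (real b)\<^sup>2))"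
    by (intro mult_left_mono order_trans[OF _ sum_inverse_squares_ge]) auto
  also have "\<dots> = (\<Sum>(a, b)\<in>{1..N-1} \<times> {1..N-1}. ?c * (1 / ((real a)\<^sup>2 + (real b)\<^sup>2)))"
    by (simp only: sum_distrib_left sum.cartesian_product) (simp only: split_def)
  also have "\<dots> \<le> (\<Sum>ab\<in>{1..N-1} \<times> {1..N-1}. ?h (?e ab))"
  proof (rule sum_mono, clarify)
    fix a b assume ab: "a \<in> {1..N-1}" "b \<in> {1..N-1}"
    have k: "(int a, int b) \<in> torus N - {(0, 0)}" using ab by (auto simp: torus_def)
    have s: "(sin (pi * r / real N))\<^sup>2 \<le> pi\<^sup>2 * r\<^sup>2 / (real N)\<^sup>2" for r
      using abs_sin_x_le_abs_x[of "pi * r / real N"]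
      unfolding abs_le_square_iff by (simp add: power_mult_distrib power_divide)
    have "1 - (eigval N (int a, int b))\<^sup>2 \<le> 8 / 5 * (pi\<^sup>2 / (real N)\<^sup>2 * ((real a)\<^sup>2 + (real b)\<^sup>2))"
      using one_minus_eigval_square_bounds(2)[of N "(int a, int b)"] s[of a] s[of b]
      unfolding one_minus_eigval by (simp add: algebra_simps)
    then have "1 / (8 / 5 * (pi\<^sup>2 / (real N)\<^sup>2 * ((real a)\<^sup>2 + (real b)\<^sup>2))) \<le> ?h (int a, int b)"
      using eigval_less_one(2)[OF k] ab assms
      by (intro divide_left_mono mult_pos_pos divide_pos_pos add_pos_pos) auto
    moreover have "?c * (1 / ((real a)\<^sup>2 + (real b)\<^sup>2))
        = 1 / (8 / 5 * (pi\<^sup>2 / (real N)\<^sup>2 * ((real a)\<^sup>2 + (real b)\<^sup>2)))"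
      by simp
    ultimately show "?c * (1 / ((real a)\<^sup>2 + (real b)\<^sup>2)) \<le> ?h (int a, int b)"
      by (simp only:)
  qed
  also have "\<dots> = sum ?h (?e ` ({1..N-1} \<times> {1..N-1}))"
    by (subst sum.reindex) (auto simp: inj_on_def)
  also have "\<dots> \<le> mean_hitting N"
    unfolding mean_hitting_def
  proof (rule sum_mono2)
    show "?e ` ({1..N-1} \<times> {1..N-1}) \<subseteq> torus N - {(0, 0)}"
      by (auto simp: torus_def)
    show "0 \<le> ?h k" if "k \<in> torus N - {(0, 0)} - ?e ` ({1..N-1} \<times> {1..N-1})" for k
      using eigval_less_one(2)[of k N] that by simp
  qed simp
  finally show ?thesis by simp
qed

text \<open>Jordan's inequality bounds the denominator below by \<open>32 / 25\<close> times the
  squared distance to the nearest corner over \<open>N^2\<close>. Four lattice sums, each at most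
  \<open>3 * harm N <= 6 * ln N\<close>, then give \<open>25 / 32 * 24 = 75 / 4\<close>.\<close>

lemma mean_hitting_le:
  assumes "N \<ge> 3"
  shows "mean_hitting N \<le> 75 / 4 * (real N)\<^sup>2 * ln (real N)"
proof -
  let ?R = "\<lambda>a b :: nat. 1 / ((real a)\<^sup>2 + (real b)\<^sup>2)"
  let ?c = "25 / 32 * (real N)\<^sup>2"
  let ?h = "\<lambda>k. if k = (0, 0) then 0 else 1 / (1 - (eigval N k)\<^sup>2)"
  text \<open>The mode \<open>a\<close> and its mirror image \<open>N - a\<close> have the same eigenvalue. Bounding the term of
    the smaller one by the sum over both makes the min disappear; the undefined \<open>?R 0 0\<close> is 0.\<close>
  define m where "m a = min a (N - a)" for a
  have sin_ge: "4 / (real N)\<^sup>2 * (real (m a))\<^sup>2 \<le> (sin (pi * real a / real N))\<^sup>2" if "a < N" for a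
  proof -
    \<comment> \<open>Reflecting the angle at \<open>pi / 2\<close> brings it into the range of
      \<open>sin_ge_linear\<close>.\<close>
    have "sin (pi * real a / real N) = sin (pi * real (m a) / real N)"
    proof (cases "a \<le> N - a")
      case False
      have "pi * real (m a) / real N = pi - pi * real a / real N"
        using that False by (simp add: m_def min_def of_nat_diff field_simps)
      then show ?thesis by simp
    qed (simp add: m_def)
    moreover have "2 * real (m a) \<le> real N" by (simp add: m_def)
    then have "2 / pi * (pi * real (m a) / real N) \<le> sin (pi * real (m a) / real N)"
      using assms by (intro sin_ge_linear) (auto simp: field_simps)
    ultimately have "2 * real (m a) / real N \<le> sin (pi * real a / real N)" by simp
    from power_mono[OF this, of 2] show ?thesis
      by (simp add: power_divide power_mult_distrib)
  qed
  have le: "?h (int a, int b) \<le> ?c * (?R a b + ?R a (N - b) + ?R (N - a) b + ?R (N - a) (N - b))"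
    if "a < N" "b < N" for a b
  proof (cases "a = 0 \<and> b = 0")
    case False
    then have k: "(int a, int b) \<in> torus N - {(0, 0)}" using that by (auto simp: torus_def)
    have mpos: "0 < (real (m a))\<^sup>2 + (real (m b))\<^sup>2"
      using False that by (auto simp: m_def min_def add_pos_nonneg add_nonneg_pos)
    have "8 / 25 * (4 / (real N)\<^sup>2 * ((real (m a))\<^sup>2 + (real (m b))\<^sup>2)) \<le> 1 - (eigval N (int a, int b))\<^sup>2"
      using one_minus_eigval_square_bounds(1)[of N "(int a, int b)"]
        sin_ge[OF that(1)] sin_ge[OF that(2)]
      unfolding one_minus_eigval by (simp add: algebra_simps)
    then have "?h (int a, int b) \<le> 1 / (8 / 25 * (4 / (real N)\<^sup>2 * ((real (m a))\<^sup>2 + (real (m b))\<^sup>2)))"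
      using mpos assms eigval_less_one(2)[OF k] False
      by (simp only: prod.inject of_nat_eq_0_iff if_False) (intro divide_left_mono mult_pos_pos, auto)
    also have "\<dots> = ?c * ?R (m a) (m b)" by (simp add: divide_simps)
    also have "\<dots> \<le> ?c * (?R a b + ?R a (N - b) + ?R (N - a) b + ?R (N - a) (N - b))"
    proof (rule mult_left_mono)
      have nn: "0 \<le> ?R i j" for i j by simp
      have "?R (m a) (m b) \<in> {?R a b, ?R a (N - b), ?R (N - a) b, ?R (N - a) (N - b)}"
        by (auto simp: m_def min_def)
      then show "?R (m a) (m b) \<le> ?R a b + ?R a (N - b) + ?R (N - a) b + ?R (N - a) (N - b)"
        using nn[of a b] nn[of a "N - b"] nn[of "N - a" b] nn[of "N - a" "N - b"]
        by (elim insertE; simp only: empty_iff; linarith)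
    qed simp
    finally show ?thesis .
  qed simp
  \<comment> \<open>As \<open>a\<close> runs below \<open>N\<close>, \<open>N - a\<close> runs over
    \<open>{1..N}\<close>. Enlarging both ranges to \<open>{0..N}\<close> bounds all four sums by
    the same \<open>?T\<close>.\<close>
  have refl_le: "(\<Sum>a<N. g (N - a)) \<le> (\<Sum>a=0..N. g a)" "(\<Sum>a<N. g a) \<le> (\<Sum>a=0..N. g a)"
    if "\<And>a. 0 \<le> g a" for g :: "nat \<Rightarrow> real"
  proof -
    have "(\<Sum>a<N. g (N - a)) = sum g {1..N}"
      by (rule sum.reindex_bij_witness[of _ "\<lambda>a. N - a" "\<lambda>a. N - a"]) auto
    also have "\<dots> \<le> (\<Sum>a=0..N. g a)" by (rule sum_mono2) (auto simp: that)
    finally show "(\<Sum>a<N. g (N - a)) \<le> (\<Sum>a=0..N. g a)" .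
    show "(\<Sum>a<N. g a) \<le> (\<Sum>a=0..N. g a)" by (rule sum_mono2) (auto simp: that)
  qed
  let ?T = "\<Sum>a=0..N. \<Sum>b=0..N. ?R a b"
  have nn: "0 \<le> ?R i j" for i j by simp
  have nns: "0 \<le> (\<Sum>b=0..N. ?R i b)" for i by (intro sum_nonneg) simp
  have T: "(\<Sum>a<N. \<Sum>b<N. ?R a b) \<le> ?T" "(\<Sum>a<N. \<Sum>b<N. ?R a (N - b)) \<le> ?T"
    "(\<Sum>a<N. \<Sum>b<N. ?R (N - a) b) \<le> ?T" "(\<Sum>a<N. \<Sum>b<N. ?R (N - a) (N - b)) \<le> ?T"
    by (rule order_trans[OF sum_mono]; (rule refl_le(1)[OF nn] refl_le(2)[OF nn] refl_le(1)[OF nns] refl_le(2)[OF nns]))+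
  \<comment> \<open>\<open>harm n - ln n\<close> decreases from 1, and
    \<open>N >= 3 >= exp 1\<close> lets \<open>ln N\<close> absorb that 1.\<close>
  have harm: "harm N \<le> 2 * ln (real N)"
  proof -
    have "harm (Suc (N - 1)) - ln (real (Suc (N - 1))) \<le> harm (Suc 0) - ln (real (Suc 0))"
      using decseq_harm_diff_ln[unfolded decseq_def] by blast
    then have "harm N \<le> 1 + ln (real N)" using assms by (simp add: harm_def)
    moreover have "1 \<le> ln (real N)"
      using assms exp_le by (subst ln_ge_iff) auto
    ultimately show ?thesis by linarith
  qed
  have "mean_hitting N = (\<Sum>k\<in>torus N. ?h k)"
    unfolding mean_hitting_def by (rule sum.mono_neutral_cong_left) auto
  also have "\<dots> \<le> (\<Sum>a<N. \<Sum>b<N. ?c * (?R a b + ?R a (N - b) + ?R (N - a) b + ?R (N - a) (N - b)))"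
    unfolding sum_torus by (intro sum_mono le) auto
  also have "\<dots> = ?c * ((\<Sum>a<N. \<Sum>b<N. ?R a b) + (\<Sum>a<N. \<Sum>b<N. ?R a (N - b))
      + (\<Sum>a<N. \<Sum>b<N. ?R (N - a) b) + (\<Sum>a<N. \<Sum>b<N. ?R (N - a) (N - b)))"
    by (simp only: sum_distrib_left[symmetric] sum.distrib)
  also have "\<dots> \<le> ?c * (4 * (3 * (2 * ln (real N))))"
    using T sum_inverse_squares_le[of N] harm by (intro mult_left_mono; (linarith | simp))
  finally show ?thesis by (simp add: algebra_simps)
qed

section \<open>The meeting time as a hitting time\<close>

text \<open>Averaging over moves instead of target vertices stays correct when several moves lead to
  the same vertex.\<close>

lemma sum_pmf_torus_step:
  assumes "N > 0"
  shows "(\<Sum>v\<in>torus N. pmf (torus_step N x) v * f v) = (\<Sum>d\<in>moves. f (torus_add N x d)) / 5"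
proof -
  have "(\<Sum>v\<in>torus N. pmf (torus_step N x) v * f v) = measure_pmf.expectation (torus_step N x) f"
    by (subst integral_measure_pmf_real[where A = "torus N"])
       (use assms in \<open>auto simp: torus_step_def torus_add_def torus_def mult.commute\<close>)
  also have "\<dots> = measure_pmf.expectation (pmf_of_set moves) (\<lambda>d. f (torus_add N x d))"
    by (simp add: torus_step_def moves_def)
  also have "\<dots> = (\<Sum>d\<in>moves. f (torus_add N x d)) / card moves"
    by (rule integral_pmf_of_set) (auto simp: moves_def)
  also have "card moves = 5" by (simp add: moves_def)
  finally show ?thesis by simp
qed

text \<open>Distinct representatives in \<open>{0..<N}\<close> are not congruent, so
  \<open>potential_step\<close> applies to their integer difference; \<open>potential_cong\<close>
  absorbs the reductions mod \<open>N\<close>.\<close>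

lemma pair_step_potential:
  assumes "N > 0" "x \<in> torus N" "y \<in> torus N" "x \<noteq> y"
  shows "(\<Sum>v\<in>torus N. \<Sum>w\<in>torus N. pmf (torus_step N x) v * pmf (torus_step N y) w * potential N (v - w))
    = potential N (x - y) - 1"
proof -
  have ndvd: "\<not> (int N dvd fst (x - y) \<and> int N dvd snd (x - y))"
  proof
    assume dvd: "int N dvd fst (x - y) \<and> int N dvd snd (x - y)"
    have "fst x mod int N = fst y mod int N" "snd x mod int N = snd y mod int N"
      using dvd by (simp_all add: mod_eq_dvd_iff)
    then show False
      using assms by (auto simp: torus_def)
  qed
  have cong: "potential N (torus_add N x d - torus_add N y e) = potential N (x - y + d - e)" for d e
  proof (rule potential_cong[OF assms(1)])
    have *: "int N dvd (a + b) mod int N - (c + d) mod int N - (a - c + b - d)" for a b c d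
    proof -
      have "(a + b) mod int N - (c + d) mod int N - (a - c + b - d)
        = int N * ((c + d) div int N - (a + b) div int N)"
        by (simp add: minus_div_mult_eq_mod[symmetric] algebra_simps)
      then show ?thesis by simp
    qed
    show "int N dvd fst (torus_add N x d - torus_add N y e) - fst (x - y + d - e)"
      "int N dvd snd (torus_add N x d - torus_add N y e) - snd (x - y + d - e)"
      using *[of "fst x" "fst d" "fst y" "fst e"] *[of "snd x" "snd d" "snd y" "snd e"]
      by (simp_all add: torus_add_def)
  qed
  have "(\<Sum>v\<in>torus N. \<Sum>w\<in>torus N. pmf (torus_step N x) v * pmf (torus_step N y) w * potential N (v - w))
    = (\<Sum>v\<in>torus N. pmf (torus_step N x) v * (\<Sum>w\<in>torus N. pmf (torus_step N y) w * potential N (v - w)))"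
    by (simp add: sum_distrib_left mult.assoc)
  also have "\<dots> = (\<Sum>d\<in>moves. \<Sum>e\<in>moves. potential N (x - y + d - e)) / 25"
    unfolding sum_pmf_torus_step[OF assms(1)] by (simp add: cong sum_divide_distrib)
  also have "\<dots> = potential N (x - y) - 1"
    unfolding potential_step[OF assms(1) ndvd] by simp
  finally show ?thesis .
qed

section \<open>A single walker: positions, initial law and Markov property\<close>

context torus_walk
begin

lemma position_in_torus: "\<omega> \<in> space M \<Longrightarrow> X t \<omega> \<in> torus N"
  using random_position[of t] by (auto simp: measurable_def)

lemma N_pos: "N > 0"
proof -
  obtain \<omega> where "\<omega> \<in> space M" using not_empty by blast
  from position_in_torus[OF this, of 0] show ?thesis by (auto simp: torus_def)
qed

lemma measurable_position [measurable]: "X t \<in> M \<rightarrow>\<^sub>M count_space UNIV"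
  by (rule measurable_compose[OF random_position, where g = "\<lambda>x. x", simplified]) auto

lemma prob_start:
  assumes "x \<in> torus N"
  shows "measure M {\<omega> \<in> space M. X 0 \<omega> = x} = 1 / (real N)\<^sup>2"
proof -
  have "measure M {\<omega> \<in> space M. X 0 \<omega> = x} = measure (distr M (count_space (torus N)) (X 0)) {x}"
    using assms random_position[of 0] by (subst measure_distr) (auto intro!: arg_cong[where f = "measure M"])
  also have "\<dots> = 1 / (real N)\<^sup>2"
    unfolding uniform_start using assms by (simp add: measure_uniform_count_measure card_torus)
  finally show ?thesis .
qed

text \<open>The Markov property in product form also covers histories of probability zero, where
  both sides vanish.\<close>

lemma prob_history_step:
  "measure M {\<omega> \<in> space M. (\<forall>i\<le>t. X i \<omega> = p i) \<and> X (Suc t) \<omega> = v} =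
   measure M {\<omega> \<in> space M. \<forall>i\<le>t. X i \<omega> = p i} * pmf (torus_step N (p t)) v"
proof (cases "measure M {\<omega> \<in> space M. \<forall>i\<le>t. X i \<omega> = p i} > 0")
  case True
  from markov[OF this, of v] True show ?thesis
    by (simp add: cond_prob_def field_simps conj_commute)
next
  case False
  have "measure M {\<omega> \<in> space M. (\<forall>i\<le>t. X i \<omega> = p i) \<and> X (Suc t) \<omega> = v}
    \<le> measure M {\<omega> \<in> space M. \<forall>i\<le>t. X i \<omega> = p i}"
    by (rule finite_measure_mono) auto
  with False show ?thesis
    by (simp add: not_less measure_le_0_iff)
qed

end

section \<open>The pair of walkers: joint histories and the law of the pair before meeting\<close>

context independent_torus_walks
begin

lemma measurable_meet [measurable]: "Measurable.pred M (\<lambda>\<omega>. X t \<omega> = Y t \<omega>)"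
proof -
  have "{\<omega> \<in> space M. X t \<omega> = Y t \<omega>} = (\<Union>x\<in>torus N. {\<omega> \<in> space M. X t \<omega> = x \<and> Y t \<omega> = x})"
    using Y.position_in_torus by auto
  also have "\<dots> \<in> sets M"
    by (intro sets.finite_UN) auto
  finally show ?thesis by (simp add: pred_def)
qed

text \<open>Independence of the trajectories as a product rule for predicates on paths; it is
  applied to events depending on finitely many coordinates.\<close>

lemma prob_paths_product:
  assumes P: "Measurable.pred (\<Pi>\<^sub>M t\<in>UNIV. count_space (torus N)) P"
    and Q: "Measurable.pred (\<Pi>\<^sub>M t\<in>UNIV. count_space (torus N)) Q"
  shows "measure M {\<omega> \<in> space M. P (\<lambda>t. X t \<omega>) \<and> Q (\<lambda>t. Y t \<omega>)} =
    measure M {\<omega> \<in> space M. P (\<lambda>t. X t \<omega>)} * measure M {\<omega> \<in> space M. Q (\<lambda>t. Y t \<omega>)}"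
proof -
  let ?S = "\<Pi>\<^sub>M t\<in>UNIV. count_space (torus N)"
  have sp: "(\<lambda>t. X t \<omega>) \<in> space ?S" "(\<lambda>t. Y t \<omega>) \<in> space ?S" if "\<omega> \<in> space M" for \<omega>
    using X.position_in_torus[OF that] Y.position_in_torus[OF that] by (auto simp: space_PiM)
  have "{f \<in> space ?S. P f} \<in> sets ?S" "{f \<in> space ?S. Q f} \<in> sets ?S"
    using P Q by (simp_all add: pred_def)
  from X.indep_varD[OF indep this] show ?thesis
    by (simp add: vimage_def Int_def sp conj_commute conj_left_commute cong: conj_cong)
qed

lemma measurable_coordinate:
  "Measurable.pred (\<Pi>\<^sub>M t\<in>UNIV. count_space (torus N)) (\<lambda>f. f (i::nat) = (v :: int \<times> int))"
proof -
  have "(\<lambda>f. f i) \<in> (\<Pi>\<^sub>M t\<in>(UNIV :: nat set). count_space (torus N)) \<rightarrow>\<^sub>M count_space (torus N)"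
    by (rule measurable_component_singleton) simp
  from measurable_compose[OF this, where g = "\<lambda>x. x = v" and L = "count_space UNIV"] show ?thesis
    by simp
qed

lemma measurable_history:
  "Measurable.pred (\<Pi>\<^sub>M t\<in>UNIV. count_space (torus N)) (\<lambda>f. \<forall>i\<le>(t::nat). f i = (p i :: int \<times> int))"
  using measurable_coordinate by (intro pred_intros_countable) auto

text \<open>Extensional functions make this set finite and give each outcome exactly one history up
  to time \<open>t\<close>.\<close>

definition histories :: "nat \<Rightarrow> ((nat \<Rightarrow> int \<times> int) \<times> (nat \<Rightarrow> int \<times> int)) set" where
  "histories t = (\<Pi>\<^sub>E i\<in>{..t}. torus N) \<times> (\<Pi>\<^sub>E i\<in>{..t}. torus N)"

definition history :: "nat \<Rightarrow> (nat \<Rightarrow> int \<times> int) \<times> (nat \<Rightarrow> int \<times> int) \<Rightarrow> 'a \<Rightarrow> bool" where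
  "history t h \<omega> \<longleftrightarrow> (\<forall>i\<le>t. X i \<omega> = fst h i) \<and> (\<forall>i\<le>t. Y i \<omega> = snd h i)"

definition apart :: "nat \<Rightarrow> (nat \<Rightarrow> int \<times> int) \<times> (nat \<Rightarrow> int \<times> int) \<Rightarrow> bool" where
  "apart t h \<longleftrightarrow> (\<forall>i\<le>t. fst h i \<noteq> snd h i)"

text \<open>The sub-probability law at time \<open>t\<close> of the pair killed on meeting.\<close>

definition surviving :: "nat \<Rightarrow> int \<times> int \<Rightarrow> int \<times> int \<Rightarrow> real" where
  "surviving t x y = measure M {\<omega> \<in> space M. (\<forall>i\<le>t. X i \<omega> \<noteq> Y i \<omega>) \<and> X t \<omega> = x \<and> Y t \<omega> = y}"

definition survival :: "nat \<Rightarrow> real" where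
  "survival t = measure M {\<omega> \<in> space M. \<forall>i\<le>t. X i \<omega> \<noteq> Y i \<omega>}"

lemma finite_histories [simp]: "finite (histories t)"
  by (simp add: histories_def finite_PiE)

lemma measurable_history_event [measurable]: "Measurable.pred M (history t h)"
  unfolding history_def by measurable

text \<open>The Markov property is assumed for each walker separately. Independence splits the event
  into one factor per walker, each factor takes its step, and the past factors recombine.\<close>

lemma prob_history_pair_step:
  "measure M {\<omega> \<in> space M. history t h \<omega> \<and> X (Suc t) \<omega> = v \<and> Y (Suc t) \<omega> = w} =
   measure M {\<omega> \<in> space M. history t h \<omega>} *
     (pmf (torus_step N (fst h t)) v * pmf (torus_step N (snd h t)) w)"
proof -
  let ?P = "\<lambda>p v f. (\<forall>i\<le>t. f i = p i) \<and> f (Suc t) = v"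
  have m: "Measurable.pred (\<Pi>\<^sub>M t\<in>UNIV. count_space (torus N)) (?P p v)" for p v
    using measurable_history measurable_coordinate by (rule pred_intros_logic)
  have "measure M {\<omega> \<in> space M. history t h \<omega> \<and> X (Suc t) \<omega> = v \<and> Y (Suc t) \<omega> = w} =
    measure M {\<omega> \<in> space M. ?P (fst h) v (\<lambda>t. X t \<omega>) \<and> ?P (snd h) w (\<lambda>t. Y t \<omega>)}"
    unfolding history_def by (rule arg_cong[where f = "measure M"]) auto
  then show ?thesis
    unfolding prob_paths_product[OF m m] history_def prob_paths_product[OF measurable_history measurable_history]
      X.prob_history_step Y.prob_history_step by simp
qed

lemma ex1_history:
  assumes "\<omega> \<in> space M"
  shows "\<exists>!h\<in>histories t. history t h \<omega>"
proof (rule ex1I[of _ "(restrict (\<lambda>i. X i \<omega>) {..t}, restrict (\<lambda>i. Y i \<omega>) {..t})"])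
  show "(restrict (\<lambda>i. X i \<omega>) {..t}, restrict (\<lambda>i. Y i \<omega>) {..t}) \<in> histories t \<and>
    history t (restrict (\<lambda>i. X i \<omega>) {..t}, restrict (\<lambda>i. Y i \<omega>) {..t}) \<omega>"
    using X.position_in_torus[OF assms] Y.position_in_torus[OF assms]
    by (auto simp: histories_def history_def)
  fix h assume h: "h \<in> histories t \<and> history t h \<omega>"
  have "fst h = restrict (\<lambda>i. X i \<omega>) {..t}"
    by (rule extensionalityI[of _ "{..t}"]) (use h in \<open>auto simp: histories_def history_def PiE_def\<close>)
  moreover have "snd h = restrict (\<lambda>i. Y i \<omega>) {..t}"
    by (rule extensionalityI[of _ "{..t}"]) (use h in \<open>auto simp: histories_def history_def PiE_def\<close>)
  ultimately show "h = (restrict (\<lambda>i. X i \<omega>) {..t}, restrict (\<lambda>i. Y i \<omega>) {..t})"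
    by (simp add: prod_eq_iff)
qed

lemma prob_sum_histories:
  assumes [measurable]: "Measurable.pred M A"
  shows "measure M {\<omega> \<in> space M. A \<omega>} = (\<Sum>h\<in>histories t. measure M {\<omega> \<in> space M. history t h \<omega> \<and> A \<omega>})"
  using ex1_history by (intro X.prob_sum) auto

lemma apart_history:
  "history t h \<omega> \<Longrightarrow> (\<forall>i\<le>t. X i \<omega> \<noteq> Y i \<omega>) \<longleftrightarrow> apart t h"
  by (simp add: history_def apart_def)

text \<open>Written with \<open>if\<close> on the endpoints, so that \<open>surviving_Suc\<close>
  can regroup a sum over histories by endpoint.\<close>

lemma surviving_eq:
  "surviving t x y = (\<Sum>h\<in>histories t.
     if fst h t = x \<and> snd h t = y then of_bool (apart t h) * measure M {\<omega> \<in> space M. history t h \<omega>} else 0)"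
proof -
  have "surviving t x y = (\<Sum>h\<in>histories t. measure M {\<omega> \<in> space M. history t h \<omega> \<and>
      ((\<forall>i\<le>t. X i \<omega> \<noteq> Y i \<omega>) \<and> X t \<omega> = x \<and> Y t \<omega> = y)})"
    unfolding surviving_def by (rule prob_sum_histories) measurable
  also have "\<dots> = (\<Sum>h\<in>histories t.
      if fst h t = x \<and> snd h t = y then of_bool (apart t h) * measure M {\<omega> \<in> space M. history t h \<omega>} else 0)"
  proof (rule sum.cong[OF refl])
    fix h
    have "{\<omega> \<in> space M. history t h \<omega> \<and> ((\<forall>i\<le>t. X i \<omega> \<noteq> Y i \<omega>) \<and> X t \<omega> = x \<and> Y t \<omega> = y)} =
      (if fst h t = x \<and> snd h t = y \<and> apart t h then {\<omega> \<in> space M. history t h \<omega>} else {})"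
      by (auto simp: history_def apart_def)
    then show "measure M {\<omega> \<in> space M. history t h \<omega> \<and> ((\<forall>i\<le>t. X i \<omega> \<noteq> Y i \<omega>) \<and> X t \<omega> = x \<and> Y t \<omega> = y)} =
      (if fst h t = x \<and> snd h t = y then of_bool (apart t h) * measure M {\<omega> \<in> space M. history t h \<omega>} else 0)"
      by simp
  qed
  finally show ?thesis .
qed

text \<open>Chapman-Kolmogorov equation of the killed pair. Being apart up to \<open>t\<close> is
  decided by the history, and \<open>v \<noteq> w\<close> takes care of time
  \<open>Suc t\<close>.\<close>

lemma surviving_Suc:
  assumes "v \<noteq> w"
  shows "surviving (Suc t) v w = (\<Sum>x\<in>torus N. \<Sum>y\<in>torus N.
    surviving t x y * (pmf (torus_step N x) v * pmf (torus_step N y) w))"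
proof -
  let ?K = "\<lambda>x y. pmf (torus_step N x) v * pmf (torus_step N y) w"
  let ?\<mu> = "\<lambda>h. of_bool (apart t h) * measure M {\<omega> \<in> space M. history t h \<omega>}"
  have "surviving (Suc t) v w = (\<Sum>h\<in>histories t. measure M {\<omega> \<in> space M. history t h \<omega> \<and>
      ((\<forall>i\<le>Suc t. X i \<omega> \<noteq> Y i \<omega>) \<and> X (Suc t) \<omega> = v \<and> Y (Suc t) \<omega> = w)})"
    unfolding surviving_def by (rule prob_sum_histories) measurable
  also have "\<dots> = (\<Sum>h\<in>histories t. ?\<mu> h * ?K (fst h t) (snd h t))"
  proof (rule sum.cong[OF refl])
    fix h
    have "{\<omega> \<in> space M. history t h \<omega> \<and> ((\<forall>i\<le>Suc t. X i \<omega> \<noteq> Y i \<omega>) \<and> X (Suc t) \<omega> = v \<and> Y (Suc t) \<omega> = w)} =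
      (if apart t h then {\<omega> \<in> space M. history t h \<omega> \<and> X (Suc t) \<omega> = v \<and> Y (Suc t) \<omega> = w} else {})"
      using apart_history[of t h] assms by (auto simp: le_Suc_eq)
    then show "measure M {\<omega> \<in> space M. history t h \<omega> \<and> ((\<forall>i\<le>Suc t. X i \<omega> \<noteq> Y i \<omega>) \<and> X (Suc t) \<omega> = v \<and> Y (Suc t) \<omega> = w)}
       = ?\<mu> h * ?K (fst h t) (snd h t)"
      by (simp add: prob_history_pair_step)
  qed
  \<comment> \<open>Redundant sums over the endpoint are inserted; after exchanging them with the
    sum over histories, the inner sum is \<open>surviving t x y\<close>.\<close>
  also have "\<dots> = (\<Sum>h\<in>histories t. \<Sum>x\<in>torus N. \<Sum>y\<in>torus N.
      if fst h t = x \<and> snd h t = y then ?\<mu> h * ?K x y else 0)"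
  proof (rule sum.cong[OF refl])
    fix h assume "h \<in> histories t"
    then have "fst h t \<in> torus N" "snd h t \<in> torus N" by (auto simp: histories_def)
    moreover have "(\<Sum>y\<in>torus N. if fst h t = x \<and> snd h t = y then ?\<mu> h * ?K x y else 0)
      = (if fst h t = x then (\<Sum>y\<in>torus N. if snd h t = y then ?\<mu> h * ?K x y else 0) else 0)" for x
      by simp
    ultimately show "?\<mu> h * ?K (fst h t) (snd h t) = (\<Sum>x\<in>torus N. \<Sum>y\<in>torus N.
      if fst h t = x \<and> snd h t = y then ?\<mu> h * ?K x y else 0)"
      by (simp only: sum.delta' finite_torus if_True)
  qed
  also have "\<dots> = (\<Sum>x\<in>torus N. \<Sum>h\<in>histories t. \<Sum>y\<in>torus N.
      if fst h t = x \<and> snd h t = y then ?\<mu> h * ?K x y else 0)"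
    by (rule sum.swap)
  also have "\<dots> = (\<Sum>x\<in>torus N. \<Sum>y\<in>torus N. \<Sum>h\<in>histories t.
      if fst h t = x \<and> snd h t = y then ?\<mu> h * ?K x y else 0)"
    by (intro sum.cong refl sum.swap)
  also have "\<dots> = (\<Sum>x\<in>torus N. \<Sum>y\<in>torus N. surviving t x y * ?K x y)"
    unfolding surviving_eq sum_distrib_right by (intro sum.cong refl) simp
  finally show ?thesis .
qed

section \<open>Survival probabilities, the remaining potential and the expected meeting time\<close>

lemma surviving_same: "surviving t x x = 0"
proof -
  have "{\<omega> \<in> space M. (\<forall>i\<le>t. X i \<omega> \<noteq> Y i \<omega>) \<and> X t \<omega> = x \<and> Y t \<omega> = x} = {}" by auto
  then show ?thesis by (simp only: surviving_def measure_empty)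
qed

lemma survival_eq: "survival t = (\<Sum>x\<in>torus N. \<Sum>y\<in>torus N. surviving t x y)"
proof -
  have "survival t = (\<Sum>z\<in>torus N \<times> torus N. measure M {\<omega> \<in> space M.
      (\<forall>i\<le>t. X i \<omega> \<noteq> Y i \<omega>) \<and> X t \<omega> = fst z \<and> Y t \<omega> = snd z})"
    unfolding survival_def
  proof (rule X.prob_sum)
    have "\<exists>!z\<in>torus N \<times> torus N. X t \<omega> = fst z \<and> Y t \<omega> = snd z" if "\<omega> \<in> space M" for \<omega>
      using X.position_in_torus[OF that] Y.position_in_torus[OF that]
      by (intro ex1I[of _ "(X t \<omega>, Y t \<omega>)"]) auto
    then show "AE \<omega> in M.
      (\<forall>z\<in>torus N \<times> torus N. (\<forall>i\<le>t. X i \<omega> \<noteq> Y i \<omega>) \<and> X t \<omega> = fst z \<and> Y t \<omega> = snd z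
        \<longrightarrow> (\<forall>i\<le>t. X i \<omega> \<noteq> Y i \<omega>)) \<and>
      ((\<forall>i\<le>t. X i \<omega> \<noteq> Y i \<omega>) \<longrightarrow>
        (\<exists>!z\<in>torus N \<times> torus N. (\<forall>i\<le>t. X i \<omega> \<noteq> Y i \<omega>) \<and> X t \<omega> = fst z \<and> Y t \<omega> = snd z))"
      by (intro AE_I2) simp
  qed simp_all
  then show ?thesis
    by (simp add: surviving_def sum.cartesian_product split_def)
qed

text \<open>The expectation of the potential of the difference on the event of no meeting up to
  \<open>t\<close>. It turns out to be the expected time still to wait, that is, the sum of
  \<open>survival s\<close> over \<open>s >= t\<close>.\<close>

definition remaining :: "nat \<Rightarrow> real" where
  "remaining t = (\<Sum>x\<in>torus N. \<Sum>y\<in>torus N. surviving t x y * potential N (x - y))"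

text \<open>Exchanging the sums moves the transition kernel from the law to the potential, which
  drops by 1 per unit of surviving mass.\<close>

lemma remaining_Suc: "remaining (Suc t) = remaining t - survival t"
proof -
  let ?T = "torus N"
  let ?K = "\<lambda>x v. pmf (torus_step N x) v"
  have "remaining (Suc t) = (\<Sum>v\<in>?T. \<Sum>w\<in>?T. (\<Sum>x\<in>?T. \<Sum>y\<in>?T.
      surviving t x y * (?K x v * ?K y w)) * potential N (v - w))"
    unfolding remaining_def
  proof (intro sum.cong refl)
    fix v w
    show "surviving (Suc t) v w * potential N (v - w) =
      (\<Sum>x\<in>?T. \<Sum>y\<in>?T. surviving t x y * (?K x v * ?K y w)) * potential N (v - w)"
      by (cases "v = w") (simp_all add: surviving_Suc potential_zero)
  qed
  also have "\<dots> = (\<Sum>v\<in>?T. \<Sum>w\<in>?T. \<Sum>(x, y)\<in>?T \<times> ?T. surviving t x y * (?K x v * ?K y w * potential N (v - w)))"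
    by (simp add: sum_distrib_right sum.cartesian_product mult.assoc split_def)
  also have "\<dots> = (\<Sum>(v, w)\<in>?T \<times> ?T. \<Sum>(x, y)\<in>?T \<times> ?T. surviving t x y * (?K x v * ?K y w * potential N (v - w)))"
    by (rule sum.cartesian_product)
  also have "\<dots> = (\<Sum>(x, y)\<in>?T \<times> ?T. \<Sum>(v, w)\<in>?T \<times> ?T. surviving t x y * (?K x v * ?K y w * potential N (v - w)))"
    unfolding split_def by (rule sum.swap)
  also have "\<dots> = (\<Sum>x\<in>?T. \<Sum>y\<in>?T. surviving t x y * (\<Sum>v\<in>?T. \<Sum>w\<in>?T. ?K x v * ?K y w * potential N (v - w)))"
    by (simp only: sum_distrib_left sum.cartesian_product[symmetric])
  also have "\<dots> = (\<Sum>x\<in>?T. \<Sum>y\<in>?T. surviving t x y * (potential N (x - y) - 1))"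
  proof (intro sum.cong refl)
    fix x y assume "x \<in> ?T" "y \<in> ?T"
    then show "surviving t x y * (\<Sum>v\<in>?T. \<Sum>w\<in>?T. ?K x v * ?K y w * potential N (v - w)) =
      surviving t x y * (potential N (x - y) - 1)"
      \<comment> \<open>The potential need not drop by 1 at the origin, but no surviving mass sits
        there.\<close>
      by (cases "x = y") (simp_all add: surviving_same pair_step_potential X.N_pos)
  qed
  also have "\<dots> = remaining t - survival t"
    by (simp add: remaining_def survival_eq sum_subtractf right_diff_distrib)
  finally show ?thesis .
qed

text \<open>Each pair of distinct starting points has probability \<open>1 / N^4\<close>. The
  diagonal carries no surviving mass but can be included, since the potential vanishes on
  it.\<close>

lemma remaining_0: "remaining 0 = mean_hitting N"
proof -
  let ?T = "torus N"
  have "remaining 0 = (\<Sum>x\<in>?T. \<Sum>y\<in>?T. 1 / (real N) ^ 4 * potential N (x - y))"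
    unfolding remaining_def
  proof (intro sum.cong refl)
    fix x y assume xy: "x \<in> ?T" "y \<in> ?T"
    show "surviving 0 x y * potential N (x - y) = 1 / (real N) ^ 4 * potential N (x - y)"
    proof (cases "x = y")
      case False
      then have "{\<omega> \<in> space M. (\<forall>i\<le>0. X i \<omega> \<noteq> Y i \<omega>) \<and> X 0 \<omega> = x \<and> Y 0 \<omega> = y}
        = {\<omega> \<in> space M. X 0 \<omega> = x \<and> Y 0 \<omega> = y}" by auto
      moreover have "measure M {\<omega> \<in> space M. X 0 \<omega> = x \<and> Y 0 \<omega> = y} = 1 / (real N)\<^sup>2 * (1 / (real N)\<^sup>2)"
        unfolding prob_paths_product[OF measurable_coordinate measurable_coordinate, of 0 x 0 y]
        using xy by (simp only: X.prob_start Y.prob_start)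
      ultimately show ?thesis by (simp add: surviving_def power2_eq_square power4_eq_xxxx)
    qed (simp add: potential_zero)
  qed
  also have "\<dots> = (\<Sum>y\<in>?T. 1 / (real N) ^ 4 * (\<Sum>x\<in>?T. potential N (x - y)))"
    by (subst sum.swap) (simp only: sum_distrib_left)
  also have "\<dots> = mean_hitting N"
    unfolding sum_potential[OF X.N_pos] using X.N_pos
    by (simp add: card_torus power2_eq_square power4_eq_xxxx)
  finally show ?thesis .
qed

lemma survival_nonneg: "0 \<le> survival t"
  by (simp add: survival_def)

lemma remaining_bounds: "0 \<le> remaining t" "remaining t \<le> 2 * mean_hitting N * survival t"
proof -
  have nn: "0 \<le> surviving t x y" for x y by (simp add: surviving_def)
  show "0 \<le> remaining t"
    unfolding remaining_def by (intro sum_nonneg mult_nonneg_nonneg nn potential_nonneg)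
  have "remaining t \<le> (\<Sum>x\<in>torus N. \<Sum>y\<in>torus N. surviving t x y * (2 * mean_hitting N))"
    unfolding remaining_def by (intro sum_mono mult_left_mono nn potential_le)
  then show "remaining t \<le> 2 * mean_hitting N * survival t"
    by (simp add: survival_eq sum_distrib_left mult_ac)
qed

text \<open>The sum telescopes. Nonnegativity of \<open>remaining\<close> bounds the partial sums,
  so \<open>survival\<close> tends to 0; the upper bound in \<open>remaining_bounds\<close> then
  forces \<open>remaining\<close> to 0 as well.\<close>

lemma survival_sums: "survival sums mean_hitting N"
proof -
  have part: "(\<Sum>t<n. survival t) = mean_hitting N - remaining n" for n
    by (induction n) (simp_all add: remaining_0 remaining_Suc)
  have "summable survival"
    by (rule summableI_nonneg_bounded[of _ "mean_hitting N"])
       (simp_all add: survival_nonneg part remaining_bounds)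
  then have "survival \<longlonglongrightarrow> 0" by (rule summable_LIMSEQ_zero)
  then have "(\<lambda>t. 2 * mean_hitting N * survival t) \<longlonglongrightarrow> 2 * mean_hitting N * 0"
    by (intro tendsto_intros)
  then have "remaining \<longlonglongrightarrow> 0"
    using remaining_bounds by (intro tendsto_sandwich[of "\<lambda>_. 0" remaining _ "\<lambda>t. 2 * mean_hitting N * survival t"]) auto
  then have "(\<lambda>n. mean_hitting N - remaining n) \<longlonglongrightarrow> mean_hitting N - 0"
    by (intro tendsto_intros)
  then show ?thesis by (simp add: sums_def part)
qed

text \<open>The meeting time counts the times \<open>t\<close> up to which no meeting has occurred;
  if the walkers never meet, both sides are infinite.\<close>

lemma meeting_time_eq_suminf:
  "meeting_time X Y \<omega> = (\<Sum>t. of_bool (\<forall>i\<le>t. X i \<omega> \<noteq> Y i \<omega>))"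
proof (cases "\<exists>t. X t \<omega> = Y t \<omega>")
  case True
  define T where "T = (LEAST t. X t \<omega> = Y t \<omega>)"
  have T: "(\<forall>i\<le>t. X i \<omega> \<noteq> Y i \<omega>) \<longleftrightarrow> t < T" for t
  proof
    assume "\<forall>i\<le>t. X i \<omega> \<noteq> Y i \<omega>"
    then show "t < T" unfolding T_def using LeastI_ex[OF True] not_le by blast
  next
    assume "t < T"
    then show "\<forall>i\<le>t. X i \<omega> \<noteq> Y i \<omega>"
      unfolding T_def using not_less_Least le_less_trans by blast
  qed
  have "(\<Sum>t. of_bool (t < T) :: ennreal) = (\<Sum>t<T. of_bool (t < T))"
    by (rule suminf_finite) auto
  then show ?thesis
    using True by (simp add: T meeting_time_def T_def[symmetric])
next
  case False
  have "(\<Sum>t::nat. 1 :: ennreal) = \<infinity>"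
    using summable_iff_suminf_neq_top[of "\<lambda>_. 1"] by (simp add: summable_const_iff)
  with False show ?thesis by (simp add: meeting_time_def)
qed

text \<open>The tail sum is integrated term by term. The value infinity is included, so almost sure
  meeting is a consequence of the formula.\<close>

theorem expected_meeting_time: "(\<integral>\<^sup>+ \<omega>. meeting_time X Y \<omega> \<partial>M) = ennreal (mean_hitting N)"
proof -
  have "(\<integral>\<^sup>+ \<omega>. meeting_time X Y \<omega> \<partial>M) =
      (\<integral>\<^sup>+ \<omega>. (\<Sum>t. indicator {\<omega> \<in> space M. \<forall>i\<le>t. X i \<omega> \<noteq> Y i \<omega>} \<omega>) \<partial>M)"
    by (rule nn_integral_cong) (simp add: meeting_time_eq_suminf indicator_def)
  also have "\<dots> = (\<Sum>t. \<integral>\<^sup>+ \<omega>. indicator {\<omega> \<in> space M. \<forall>i\<le>t. X i \<omega> \<noteq> Y i \<omega>} \<omega> \<partial>M)"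
    by (rule nn_integral_suminf) measurable
  also have "\<dots> = (\<Sum>t. ennreal (survival t))"
    by (simp add: survival_def X.emeasure_eq_measure)
  also have "\<dots> = ennreal (mean_hitting N)"
    by (rule suminf_ennreal_eq[OF survival_nonneg survival_sums])
  finally show ?thesis .
qed

end

theorem mainTheorem4:
  fixes M :: "nat \<Rightarrow> 'a measure"
    and X Y :: "nat \<Rightarrow> nat \<Rightarrow> 'a \<Rightarrow> int \<times> int"
  assumes "\<And>N. N \<ge> 3 \<Longrightarrow> independent_torus_walks N (M N) (X N) (Y N)"
  shows "\<exists>c C :: real. 0 < c \<and> c \<le> C \<and>
    (\<forall>\<^sub>F N in sequentially.
      ennreal (c * (real N)\<^sup>2 * ln (real N)) \<le> (\<integral>\<^sup>+ \<omega>. meeting_time (X N) (Y N) \<omega> \<partial>M N) \<and>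
      (\<integral>\<^sup>+ \<omega>. meeting_time (X N) (Y N) \<omega> \<partial>M N) \<le> ennreal (C * (real N)\<^sup>2 * ln (real N)))"
proof (intro exI conjI)
  \<comment> \<open>The two constants are those of \<open>mean_hitting_ge\<close> and
    \<open>mean_hitting_le\<close>, valid from \<open>N = 3\<close> on.\<close>
  show "0 < 5 / (16 * pi\<^sup>2)" by simp
  have "1 \<le> pi\<^sup>2" using pi_ge_two by (simp add: one_le_power)
  then show "5 / (16 * pi\<^sup>2) \<le> 75 / 4" by (simp add: divide_simps)
  show "\<forall>\<^sub>F N in sequentially.
      ennreal (5 / (16 * pi\<^sup>2) * (real N)\<^sup>2 * ln (real N)) \<le> (\<integral>\<^sup>+ \<omega>. meeting_time (X N) (Y N) \<omega> \<partial>M N) \<and>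
      (\<integral>\<^sup>+ \<omega>. meeting_time (X N) (Y N) \<omega> \<partial>M N) \<le> ennreal (75 / 4 * (real N)\<^sup>2 * ln (real N))"
    using eventually_ge_at_top[of 3]
  proof eventually_elim
    case (elim N)
    interpret independent_torus_walks N "M N" "X N" "Y N" by (rule assms[OF elim])
    show ?case
      unfolding expected_meeting_time
      using mean_hitting_ge[OF elim] mean_hitting_le[OF elim] by (auto intro: ennreal_leI)
  qed
qed

end
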